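(* Consider a system comprised of $N$ subsystems $$\dot x_i=-a_ix_i+\sum_{(i,j)\in\mathcal{E}}\left(u_{ij}-u_{ji}\right)+w_i,\qquad i=1,\dots,N,$$ where $a_i>0$ for all $i=1,\dots,N$ and $(i,j)\in\mathcal{E}$ if and only if subsystems $i$ and $j$ are connected. Let $y=x=(x_1,\dots,x_N)^T$, $w=(w_1,\dots,w_N)^T$, and let $u$ be the vector whose entries are the control inputs $u_{ij}$, $(i,j)\in\mathcal{E}$. Then the control law $$u_{ij}=-\frac{x_i}{a_i}+\frac{x_j}{a_j},\qquad (i,j)\in\mathcal{E},$$ solves the $H_\infty$ optimal control problem $$\inf_{\tilde K\in RL_\infty}\left\|\begin{bmatrix} I\\ \tilde K\end{bmatrix}(sI-A-B\tilde K)^{-1}\right\|_\infty ,$$ where $\dot x=Ax+Bu+w$ is the matrix form of the overall system.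
   Context: Connectedness (interconnection) is a symmetric relation between distinct subsystems, so $(i,j)\in\mathcal{E}$ if and only if $(j,i)\in\mathcal{E}$; there is one scalar input $u_{ij}$ for each ordered pair $(i,j)\in\mathcal{E}$, and for each $i$ the sum is over all $j$ with $(i,j)\in\mathcal{E}$. Thus $A$ is diagonal with $A_{ii}=-a_i$, and the column of $B$ corresponding to $u_{ij}$ has entry $1$ in row $i$, entry $-1$ in row $j$ and zeros elsewhere. $RH_\infty$ is the set of proper real rational stable transfer matrices (all poles in the open left half plane), with norm $\|H\|_\infty=\sup_{\mathrm{Re}(s)>0}\|H(s)\|=\sup_{\omega\in\mathbb{R}}\|H(\sqrt{-1}\,\omega)\|$, where $\|\cdot\|$ on matrices is the spectral norm. $RL_\infty$ is the set of proper real rational matrix functions with no poles on the imaginary axis. The problem asks for a stabilizing controller $\hat u=\tilde K\hat y$ (all of $y=x$ being available) minimizing the $H_\infty$ norm of the closed-loop map from $w$ to $(y,u)$. The infimum is over $\tilde K\in RL_\infty$ (of compatible size) that are stabilizing, i.e. $(sI-A-B\tilde K)^{-1}\in RH_\infty$. A static control law $u=Kx$ "solves" the problem if $K$ is feasible (stabilizing) and attains the infimum. *)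

theory Defs
  imports
    "Jordan_Normal_Form.Gauss_Jordan_Elimination"
    "HOL-Computational_Algebra.Polynomial_Factorial"
    "HOL-Computational_Algebra.Field_as_Ring"
    "HOL-Analysis.L2_Norm"
    "HOL-Library.Extended_Real"
begin

type_synonym ratfun = "real poly fract"

definition const_rf :: "real \<Rightarrow> ratfun" where
  "const_rf c = to_fract [:c:]"

definition s_rf :: ratfun where
  "s_rf = to_fract [:0, 1:]"

text \<open>\<open>quot_of_fract\<close> yields a coprime numerator-denominator pair, so the zeros of the
  denominator are exactly the poles.\<close>

definition num_rf :: "ratfun \<Rightarrow> real poly" where
  "num_rf f = fst (quot_of_fract f)"

definition den_rf :: "ratfun \<Rightarrow> real poly" where
  "den_rf f = snd (quot_of_fract f)"

definition poles :: "ratfun \<Rightarrow> complex set" where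
  "poles f = {z. poly (map_poly complex_of_real (den_rf f)) z = 0}"

definition proper :: "ratfun \<Rightarrow> bool" where
  "proper f \<longleftrightarrow> degree (num_rf f) \<le> degree (den_rf f)"

text \<open>Meaningful for \<open>z\<close> outside \<open>poles f\<close> only.\<close>

definition eval_rf :: "ratfun \<Rightarrow> complex \<Rightarrow> complex" where
  "eval_rf f z = poly (map_poly complex_of_real (num_rf f)) z /
                 poly (map_poly complex_of_real (den_rf f)) z"

definition RH_inf :: "nat \<Rightarrow> nat \<Rightarrow> ratfun mat set" where
  "RH_inf m n = {H \<in> carrier_mat m n.
     \<forall>i<m. \<forall>j<n. proper (H $$ (i, j)) \<and> (\<forall>z \<in> poles (H $$ (i, j)). Re z < 0)}"

definition RL_inf :: "nat \<Rightarrow> nat \<Rightarrow> ratfun mat set" where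
  "RL_inf m n = {H \<in> carrier_mat m n.
     \<forall>i<m. \<forall>j<n. proper (H $$ (i, j)) \<and> (\<forall>z \<in> poles (H $$ (i, j)). Re z \<noteq> 0)}"

definition vec_norm2 :: "complex vec \<Rightarrow> real" where
  "vec_norm2 v = L2_set (\<lambda>i. cmod (v $ i)) {..<dim_vec v}"

definition spectral_norm :: "complex mat \<Rightarrow> real" where
  "spectral_norm M = (SUP v \<in> {v \<in> carrier_vec (dim_col M). vec_norm2 v \<le> 1}. vec_norm2 (M *\<^sub>v v))"

text \<open>The supremum is taken over the imaginary axis: this makes sense on all of \<open>RL_inf\<close>, and on
  \<open>RH_inf\<close> it agrees with the supremum over the open right half plane. A closed-loop map with a
  controller in \<open>RL_inf\<close> is in general only in \<open>RL_inf\<close>.\<close>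

definition inf_norm :: "ratfun mat \<Rightarrow> ereal" where
  "inf_norm H = (SUP \<omega>::real.
     ereal (spectral_norm (map_mat (\<lambda>f. eval_rf f (\<i> * complex_of_real \<omega>)) H)))"

definition return_diff :: "real mat \<Rightarrow> real mat \<Rightarrow> ratfun mat \<Rightarrow> ratfun mat" where
  "return_diff A B K =
     s_rf \<cdot>\<^sub>m 1\<^sub>m (dim_row A) - map_mat const_rf A - map_mat const_rf B * K"

definition stabilizing :: "real mat \<Rightarrow> real mat \<Rightarrow> ratfun mat \<Rightarrow> bool" where
  "stabilizing A B K \<longleftrightarrow>
     (\<exists>G. mat_inverse (return_diff A B K) = Some G \<and> G \<in> RH_inf (dim_row A) (dim_row A))"

definition feasible :: "real mat \<Rightarrow> real mat \<Rightarrow> ratfun mat set" where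
  "feasible A B = {K \<in> RL_inf (dim_col B) (dim_row A). stabilizing A B K}"

definition closed_loop :: "real mat \<Rightarrow> real mat \<Rightarrow> ratfun mat \<Rightarrow> ratfun mat" where
  "closed_loop A B K = (1\<^sub>m (dim_row A) @\<^sub>r K) * the (mat_inverse (return_diff A B K))"

definition solves_hinf :: "real mat \<Rightarrow> real mat \<Rightarrow> real mat \<Rightarrow> bool" where
  "solves_hinf A B K \<longleftrightarrow>
     map_mat const_rf K \<in> feasible A B \<and>
     inf_norm (closed_loop A B (map_mat const_rf K)) =
       (INF L \<in> feasible A B. inf_norm (closed_loop A B L))"

text \<open>Subsystems are numbered from \<open>0\<close>. The list \<open>es\<close> enumerates the ordered pairs of connected
  subsystems; the input for the pair \<open>es ! k\<close> is the \<open>k\<close>-th entry of \<open>u\<close>.\<close>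

definition sys_A :: "nat \<Rightarrow> (nat \<Rightarrow> real) \<Rightarrow> real mat" where
  "sys_A N a = mat N N (\<lambda>(i, j). if i = j then - a i else 0)"

definition sys_B :: "nat \<Rightarrow> (nat \<times> nat) list \<Rightarrow> real mat" where
  "sys_B N es = mat N (length es)
     (\<lambda>(r, k). if r = fst (es ! k) then 1 else if r = snd (es ! k) then - 1 else 0)"

definition law_K :: "nat \<Rightarrow> (nat \<Rightarrow> real) \<Rightarrow> (nat \<times> nat) list \<Rightarrow> real mat" where
  "law_K N a es = mat (length es) N
     (\<lambda>(k, r). if r = fst (es ! k) then - 1 / a r else if r = snd (es ! k) then 1 / a r else 0)"

lemma law_K_eq:
  assumes "set es \<subseteq> {..<N} \<times> {..<N}" and "irrefl (set es)"
    and x: "x \<in> carrier_vec N" and k: "k < length es" and e: "es ! k = (i, j)"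
  shows "(law_K N a es *\<^sub>v x) $ k = - (x $ i / a i) + x $ j / a j"
proof -
  have "(i, j) \<in> set es" using k e by (metis nth_mem)
  then have ij: "i < N" "j < N" "i \<noteq> j" using assms(1,2) by (auto simp: irrefl_def)
  have "(law_K N a es *\<^sub>v x) $ k =
      (\<Sum>r = 0..<N. (if r = i then - 1 / a r else if r = j then 1 / a r else 0) * x $ r)"
    using k x e by (auto simp: law_K_def scalar_prod_def intro!: sum.cong)
  also have "\<dots> = (\<Sum>r = 0..<N. (if r = i then - (x $ i / a i) else 0) + (if r = j then x $ j / a j else 0))"
    using ij by (intro sum.cong) auto
  also have "\<dots> = - (x $ i / a i) + x $ j / a j"
    using ij by (simp add: sum.distrib)
  finally show ?thesis .
qed

lemma sys_dynamics:
  assumes sub: "set es \<subseteq> {..<N} \<times> {..<N}" and irr: "irrefl (set es)"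
    and sym: "sym (set es)" and dist: "distinct es"
    and x: "x \<in> carrier_vec N" and i: "i < N"
  shows "(sys_A N a *\<^sub>v x + sys_B N es *\<^sub>v vec (length es) (\<lambda>k. u (es ! k))) $ i =
     - a i * x $ i + (\<Sum>j | (i, j) \<in> set es. u (i, j) - u (j, i))"
proof -
  have A: "(sys_A N a *\<^sub>v x) $ i = - a i * x $ i"
  proof -
    have "(sys_A N a *\<^sub>v x) $ i = (\<Sum>r = 0..<N. (if i = r then - a i else 0) * x $ r)"
      using i x by (simp add: sys_A_def scalar_prod_def)
    also have "\<dots> = (\<Sum>r = 0..<N. if i = r then - a i * x $ i else 0)"
      by (intro sum.cong) auto
    finally show ?thesis using i by simp
  qed
  define g where "g e = (if i = fst e then u e else if i = snd e then - u e else 0)" for e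
  have fin: "finite {j. (i, j) \<in> set es}"
    by (rule finite_subset[of _ "{..<N}"]) (use sub in auto)
  have "(sys_B N es *\<^sub>v vec (length es) (\<lambda>k. u (es ! k))) $ i =
      (\<Sum>k = 0..<length es. g (es ! k))"
    using i by (auto simp: sys_B_def scalar_prod_def g_def intro!: sum.cong)
  also have "\<dots> = (\<Sum>e \<in> set es. g e)"
    by (subst sum_list_distinct_conv_sum_set[OF dist, symmetric]) (simp add: sum_list_sum_nth)
  also have "\<dots> = (\<Sum>e \<in> set es. (if i = fst e then u e else 0) + (if i = snd e then - u e else 0))"
    using irr by (intro sum.cong) (auto simp: g_def irrefl_def)
  also have "\<dots> = (\<Sum>e | e \<in> set es \<and> i = fst e. u e) + (\<Sum>e | e \<in> set es \<and> i = snd e. - u e)"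
    by (simp add: sum.distrib sum.inter_filter)
  also have "(\<Sum>e | e \<in> set es \<and> i = fst e. u e) = (\<Sum>j | (i, j) \<in> set es. u (i, j))"
    by (rule sum.reindex_bij_witness[of _ "\<lambda>j. (i, j)" snd]) auto
  also have "(\<Sum>e | e \<in> set es \<and> i = snd e. - u e) = (\<Sum>j | (i, j) \<in> set es. - u (j, i))"
    by (rule sum.reindex_bij_witness[of _ "\<lambda>j. (j, i)" fst]) (use sym in \<open>auto simp: sym_def\<close>)
  finally have B: "(sys_B N es *\<^sub>v vec (length es) (\<lambda>k. u (es ! k))) $ i =
      (\<Sum>j | (i, j) \<in> set es. u (i, j) - u (j, i))"
    by (simp add: sum_subtractf sum_negf)
  show ?thesis using A B i by (simp add: sys_A_def sys_B_def)
qed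

end

theory Submission
  imports Defs "Jordan_Normal_Form.Char_Poly"
begin

text \<open>The law is \<open>K = B\<^sup>T A\<^sup>-\<^sup>1\<close>, and it is optimal for every symmetric negative definite \<open>A\<close>
  and every \<open>B\<close>; this is \<open>symmetric_hinf_optimal\<close>. The network is the case of a diagonal \<open>A\<close>.

  \<^item> No stabilizing controller does better than a bound set by the plant at frequency zero. There a
  closed loop turns a constant disturbance \<open>w\<close> into an equilibrium \<open>(x, u)\<close> with \<open>w = - A x - B u\<close>.
  So the closed loop is a right inverse of \<open>- [A, B]\<close>, whatever the controller is. Pairing the
  equilibrium for \<open>w = p\<close> with \<open>p\<close> itself and applying Cauchy-Schwarz gives
  \<open>|p| \<le> \<sigma> |(A p, B\<^sup>T p)|\<close>, where \<open>\<sigma>\<close> is the gain of the closed loop at frequency zero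
  (\<open>static_gain_lower_bound\<close>).

  \<^item> The law meets this bound at every frequency. Write the state as \<open>x = A p\<close>; then \<open>u = K x = B\<^sup>T p\<close>,
  so the output \<open>(x, u)\<close> is \<open>q = (A p, B\<^sup>T p)\<close>, the very vector in the lower bound. Pairing
  \<open>w = z x - A x - B u\<close> with \<open>p\<close> gives \<open>z \<langle>A p, p\<rangle> - |q|\<^sup>2\<close>. As \<open>\<langle>A p, p\<rangle>\<close> is real and at most
  zero, \<open>|q|\<^sup>2 \<le> |p| |w|\<close> for every \<open>z\<close> in the closed right half plane (\<open>energy_estimate\<close>).

  Together \<open>|q|\<^sup>2 \<le> |p| |w| \<le> \<sigma> |q| |w|\<close>, that is \<open>|q| \<le> \<sigma> |w|\<close>, for the \<open>\<sigma>\<close> of any competitor.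
  The energy estimate with \<open>w = 0\<close> also shows that \<open>A + B K\<close> has no eigenvalue in the closed right
  half plane. By Cramer's rule the entries of the resolvent are then proper and stable
  (\<open>resolvent_in_RH_inf\<close>), so the law is stabilizing.

  To carry these pointwise arguments over to rational matrices, identities between them are
  evaluated at a point of the imaginary axis. Evaluation respects sums and products of rational
  functions without a pole at that point, and neither a feasible controller nor the inverse
  return difference has poles on that axis.\<close>

section \<open>Euclidean geometry of complex vectors\<close>

abbreviation cmat :: "real mat \<Rightarrow> complex mat" where
  "cmat \<equiv> map_mat complex_of_real"

lemma vec_norm2_nonneg: "vec_norm2 v \<ge> 0"
  by (simp add: vec_norm2_def L2_set_nonneg)

lemma vec_norm2_square: "complex_of_real ((vec_norm2 v)\<^sup>2) = v \<bullet>c v"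
proof -
  have "(vec_norm2 v)\<^sup>2 = (\<Sum>i<dim_vec v. (cmod (v $ i))\<^sup>2)"
    by (simp add: vec_norm2_def L2_set_def sum_nonneg)
  then show ?thesis
    by (simp add: scalar_prod_def complex_norm_square[symmetric] atLeast0LessThan del: of_real_power)
qed

lemma vec_norm2_eq_0:
  assumes "v \<in> carrier_vec n" and "vec_norm2 v = 0"
  shows "v = 0\<^sub>v n"
  using assms vec_norm2_square[of v] conjugate_square_eq_0_vec[OF assms(1)] by simp

lemma cauchy_schwarz_cvec:
  assumes "x \<in> carrier_vec n" and "y \<in> carrier_vec n"
  shows "cmod (x \<bullet>c y) \<le> vec_norm2 x * vec_norm2 y"
proof -
  have "cmod (x \<bullet>c y) \<le> (\<Sum>i<n. cmod (x $ i) * cmod (y $ i))"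
    using assms
    by (auto simp: scalar_prod_def atLeast0LessThan norm_mult intro!: order_trans[OF norm_sum] sum_mono)
  also have "\<dots> \<le> vec_norm2 x * vec_norm2 y"
    using L2_set_mult_ineq[of "\<lambda>i. cmod (x $ i)" "\<lambda>i. cmod (y $ i)" "{..<n}"] assms
    by (simp add: vec_norm2_def)
  finally show ?thesis .
qed

lemma cscalar_prod_append:
  assumes "x \<in> carrier_vec n" "u \<in> carrier_vec m" "y \<in> carrier_vec n" "v \<in> carrier_vec m"
  shows "(x @\<^sub>v u) \<bullet>c (y @\<^sub>v v) = x \<bullet>c y + u \<bullet>c v"
proof -
  have "conjugate (y @\<^sub>v v) = conjugate y @\<^sub>v conjugate v"
    using assms by (intro eq_vecI) auto
  then show ?thesis
    using scalar_prod_append[OF assms(1,2), of "conjugate y" "conjugate v"] assms by simp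
qed

lemma vec_norm2_append_square:
  "(vec_norm2 (x @\<^sub>v u))\<^sup>2 = (vec_norm2 x)\<^sup>2 + (vec_norm2 u)\<^sup>2"
proof -
  have "complex_of_real ((vec_norm2 (x @\<^sub>v u))\<^sup>2) = complex_of_real ((vec_norm2 x)\<^sup>2 + (vec_norm2 u)\<^sup>2)"
    unfolding vec_norm2_square of_real_add
    by (rule cscalar_prod_append[of _ "dim_vec x" _ "dim_vec u"]) auto
  then show ?thesis by (simp only: of_real_eq_iff)
qed

lemma vec_norm2_smult: "vec_norm2 (c \<cdot>\<^sub>v v) = cmod c * vec_norm2 v"
  by (simp add: vec_norm2_def norm_mult L2_set_right_distrib cong: L2_set_cong_simp)

text \<open>A real matrix commutes with conjugation, so its adjoint is its transpose.\<close>

lemma cscalar_prod_adjoint: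
  assumes M: "M \<in> carrier_mat n m" and x: "x \<in> carrier_vec m" and y: "y \<in> carrier_vec n"
  shows "(cmat M *\<^sub>v x) \<bullet>c y = x \<bullet>c (cmat M\<^sup>T *\<^sub>v y)"
proof -
  have conj: "conjugate (cmat M\<^sup>T *\<^sub>v y) = cmat M\<^sup>T *\<^sub>v conjugate y"
    using M y by (intro eq_vecI) (auto simp: scalar_prod_def intro!: sum.cong)
  have "((cmat M\<^sup>T)\<^sup>T *\<^sub>v x) \<bullet> conjugate y = x \<bullet> (cmat M\<^sup>T *\<^sub>v conjugate y)"
    by (rule transpose_vec_mult_scalar) (use M x y in auto)
  moreover have "(cmat M\<^sup>T)\<^sup>T = cmat M" by (rule eq_matI) auto
  ultimately show ?thesis using conj by simp
qed

text \<open>The supremum in the spectral norm is over a bounded set, because Cauchy-Schwarz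
  bounds each entry of \<open>M v\<close> by the norm of the conjugated row of \<open>M\<close>.\<close>

lemma vec_norm2_le_spectral_norm_unit:
  assumes v: "v \<in> carrier_vec (dim_col M)" and "vec_norm2 v \<le> 1"
  shows "vec_norm2 (M *\<^sub>v v) \<le> spectral_norm M"
  unfolding spectral_norm_def
proof (rule cSUP_upper)
  let ?c = "\<Sum>i<dim_row M. vec_norm2 (conjugate (row M i))"
  have "vec_norm2 (M *\<^sub>v x) \<le> ?c" if x: "x \<in> carrier_vec (dim_col M)" "vec_norm2 x \<le> 1" for x
  proof -
    have entry: "cmod ((M *\<^sub>v x) $ i) \<le> vec_norm2 (conjugate (row M i))" if i: "i < dim_row M" for i
    proof -
      have "(M *\<^sub>v x) $ i = x \<bullet>c conjugate (row M i)"
        using i x by (simp add: comm_scalar_prod[of _ "dim_col M"])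
      then have "cmod ((M *\<^sub>v x) $ i) \<le> vec_norm2 x * vec_norm2 (conjugate (row M i))"
        using cauchy_schwarz_cvec[of x "dim_col M" "conjugate (row M i)"] x by simp
      also have "\<dots> \<le> vec_norm2 (conjugate (row M i))"
        using mult_right_mono[OF x(2) vec_norm2_nonneg] by simp
      finally show ?thesis .
    qed
    have "vec_norm2 (M *\<^sub>v x) \<le> (\<Sum>i<dim_row M. \<bar>cmod ((M *\<^sub>v x) $ i)\<bar>)"
      unfolding vec_norm2_def by (rule order_trans[OF L2_set_le_sum_abs]) simp
    also have "\<dots> \<le> ?c" using entry by (intro sum_mono) simp
    finally show ?thesis .
  qed
  then show "bdd_above ((\<lambda>x. vec_norm2 (M *\<^sub>v x)) ` {v \<in> carrier_vec (dim_col M). vec_norm2 v \<le> 1})"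
    by (intro bdd_aboveI[of _ ?c]) auto
qed (use assms in auto)

lemma vec_norm2_le_spectral_norm:
  assumes v: "v \<in> carrier_vec (dim_col M)"
  shows "vec_norm2 (M *\<^sub>v v) \<le> spectral_norm M * vec_norm2 v"
proof (cases "vec_norm2 v = 0")
  case True
  then have "v = 0\<^sub>v (dim_col M)" by (rule vec_norm2_eq_0[OF v])
  then have "M *\<^sub>v v = 0 \<cdot>\<^sub>v (M *\<^sub>v v)" by (intro eq_vecI) auto
  then have "vec_norm2 (M *\<^sub>v v) = 0"
    using vec_norm2_smult[of 0 "M *\<^sub>v v"] by simp
  then show ?thesis using True by simp
next
  case False
  then have pos: "vec_norm2 v > 0" using vec_norm2_nonneg[of v] by simp
  let ?c = "complex_of_real (1 / vec_norm2 v)"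
  have "vec_norm2 (M *\<^sub>v (?c \<cdot>\<^sub>v v)) \<le> spectral_norm M"
    by (rule vec_norm2_le_spectral_norm_unit) (use v pos in \<open>auto simp: vec_norm2_smult norm_divide\<close>)
  moreover have "M *\<^sub>v (?c \<cdot>\<^sub>v v) = ?c \<cdot>\<^sub>v (M *\<^sub>v v)"
    using v by (intro mult_mat_vec) auto
  ultimately show ?thesis
    using pos by (simp add: vec_norm2_smult norm_divide field_simps)
qed

lemma spectral_norm_nonneg: "spectral_norm M \<ge> 0"
proof -
  have "0\<^sub>v (dim_col M) \<in> carrier_vec (dim_col M)" "vec_norm2 (0\<^sub>v (dim_col M)) \<le> 1"
    by (simp_all add: vec_norm2_def L2_set_def)
  then show ?thesis using vec_norm2_le_spectral_norm_unit vec_norm2_nonneg order_trans by metis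
qed

lemma spectral_norm_le:
  assumes "\<And>v. v \<in> carrier_vec (dim_col M) \<Longrightarrow> vec_norm2 v \<le> 1 \<Longrightarrow> vec_norm2 (M *\<^sub>v v) \<le> c"
  shows "spectral_norm M \<le> c"
  unfolding spectral_norm_def
proof (rule cSUP_least)
  have "vec_norm2 (0\<^sub>v (dim_col M)) \<le> 1" by (simp add: vec_norm2_def L2_set_def)
  then show "{v \<in> carrier_vec (dim_col M). vec_norm2 v \<le> 1} \<noteq> {}" by fastforce
qed (use assms in auto)

section \<open>Evaluation of rational functions and of rational matrices\<close>

abbreviation cpoly :: "real poly \<Rightarrow> complex \<Rightarrow> complex" where
  "cpoly p z \<equiv> poly (map_poly complex_of_real p) z"

lemma cpoly_mult: "cpoly (p * q) z = cpoly p z * cpoly q z"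
  and cpoly_add: "cpoly (p + q) z = cpoly p z + cpoly q z"
proof -
  interpret map_poly_comm_ring_hom complex_of_real ..
  show "cpoly (p * q) z = cpoly p z * cpoly q z" "cpoly (p + q) z = cpoly p z + cpoly q z"
    by (simp_all add: hom_distribs)
qed

lemma cpoly_den_nz: "z \<notin> poles f \<longleftrightarrow> cpoly (den_rf f) z \<noteq> 0"
  by (simp add: poles_def)

lemma den_rf_nonzero: "den_rf f \<noteq> 0"
  by (simp add: den_rf_def)

lemma Fract_num_den: "Fract (num_rf f) (den_rf f) = f"
  by (simp add: num_rf_def den_rf_def)

lemma num_den_cross:
  assumes "q \<noteq> 0" and "f = Fract p q"
  shows "num_rf f * q = p * den_rf f"
  using assms Fract_num_den[of f] den_rf_nonzero[of f] by (metis eq_fract(1))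

text \<open>By coprimality the reduced denominator divides every other one, so writing \<open>f\<close> as any quotient
  bounds its poles by the zeros of that denominator.\<close>

lemma den_rf_dvd:
  assumes "q \<noteq> 0" and "f = Fract p q"
  shows "den_rf f dvd q"
proof -
  have "den_rf f dvd num_rf f * q" using num_den_cross[OF assms] by simp
  moreover have "coprime (den_rf f) (num_rf f)"
    using coprime_quot_of_fract[of f] by (simp add: num_rf_def den_rf_def coprime_commute)
  ultimately show ?thesis by (simp add: coprime_dvd_mult_right_iff)
qed

lemma poles_Fract_imp_root:
  assumes "q \<noteq> 0" and "z \<in> poles (Fract p q)"
  shows "cpoly q z = 0"
proof -
  obtain r where "q = den_rf (Fract p q) * r" using den_rf_dvd[OF assms(1) refl] by blast
  then have "cpoly q z = cpoly (den_rf (Fract p q)) z * cpoly r z" by (metis cpoly_mult)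
  then show ?thesis using assms(2) by (simp add: poles_def)
qed

lemma eval_rf_Fract:
  assumes q: "cpoly q z \<noteq> 0"
  shows "z \<notin> poles (Fract p q)" and "eval_rf (Fract p q) z = cpoly p z / cpoly q z"
proof -
  have q0: "q \<noteq> 0" using q by auto
  show reg: "z \<notin> poles (Fract p q)" using poles_Fract_imp_root[OF q0] q by blast
  have "cpoly (num_rf (Fract p q)) z * cpoly q z = cpoly p z * cpoly (den_rf (Fract p q)) z"
    using num_den_cross[OF q0 refl] by (metis cpoly_mult)
  then show "eval_rf (Fract p q) z = cpoly p z / cpoly q z"
    using q reg by (simp add: eval_rf_def cpoly_den_nz field_simps)
qed

text \<open>The difference of the degrees of numerator and denominator does not change under reduction.\<close>

lemma proper_Fract:
  assumes q: "q \<noteq> 0" and deg: "degree p \<le> degree q"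
  shows "proper (Fract p q)"
proof (cases "p = 0")
  case True
  then have "Fract p q = 0" using q by (simp add: Zero_fract_def eq_fract)
  then show ?thesis by (simp add: proper_def num_rf_def)
next
  case False
  let ?f = "Fract p q"
  have eq: "num_rf ?f * q = p * den_rf ?f" using num_den_cross[OF q refl] .
  then have "num_rf ?f \<noteq> 0" using False den_rf_nonzero[of ?f] by auto
  then have "degree (num_rf ?f) + degree q = degree p + degree (den_rf ?f)"
    using arg_cong[OF eq, of degree] q False den_rf_nonzero[of ?f] by (simp add: degree_mult_eq)
  then show ?thesis using deg by (simp add: proper_def)
qed

lemma eval_rf_add:
  assumes "z \<notin> poles f" and "z \<notin> poles g"
  shows "z \<notin> poles (f + g)" and "eval_rf (f + g) z = eval_rf f z + eval_rf g z"
proof -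
  let ?p = "num_rf f * den_rf g + num_rf g * den_rf f" and ?q = "den_rf f * den_rf g"
  have fg: "f + g = Fract ?p ?q"
    using add_fract[OF den_rf_nonzero[of f] den_rf_nonzero[of g]] Fract_num_den by metis
  have q: "cpoly ?q z \<noteq> 0" using assms by (simp add: cpoly_mult cpoly_den_nz)
  show "z \<notin> poles (f + g)" unfolding fg by (rule eval_rf_Fract[OF q])
  have "eval_rf (f + g) z = cpoly ?p z / cpoly ?q z" unfolding fg by (rule eval_rf_Fract[OF q])
  also have "\<dots> = eval_rf f z + eval_rf g z"
    using assms unfolding eval_rf_def cpoly_mult cpoly_add cpoly_den_nz
    by (rule add_frac_eq[symmetric])
  finally show "eval_rf (f + g) z = eval_rf f z + eval_rf g z" .
qed

lemma eval_rf_mult: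
  assumes "z \<notin> poles f" and "z \<notin> poles g"
  shows "z \<notin> poles (f * g)" and "eval_rf (f * g) z = eval_rf f z * eval_rf g z"
proof -
  let ?p = "num_rf f * num_rf g" and ?q = "den_rf f * den_rf g"
  have fg: "f * g = Fract ?p ?q"
    using mult_fract[of "num_rf f" "den_rf f" "num_rf g" "den_rf g"] by (simp add: Fract_num_den)
  have q: "cpoly ?q z \<noteq> 0" using assms by (simp add: cpoly_mult cpoly_den_nz)
  show "z \<notin> poles (f * g)" "eval_rf (f * g) z = eval_rf f z * eval_rf g z"
    unfolding fg using eval_rf_Fract[OF q, of ?p] by (simp_all add: eval_rf_def cpoly_mult)
qed

lemma eval_rf_to_fract:
  "z \<notin> poles (to_fract p)" "eval_rf (to_fract p) z = cpoly p z"
  using eval_rf_Fract[of 1 z p] by (simp_all add: to_fract_def)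

lemma eval_rf_const: "z \<notin> poles (const_rf c)" "eval_rf (const_rf c) z = of_real c"
  by (simp_all add: const_rf_def eval_rf_to_fract map_poly_simps)

lemma proper_const: "proper (const_rf c)"
  by (simp add: const_rf_def to_fract_def proper_Fract)

lemma eval_rf_0_1: "z \<notin> poles 0" "eval_rf 0 z = 0" "z \<notin> poles 1" "eval_rf 1 z = 1"
  using eval_rf_to_fract(1)[of z 0] eval_rf_to_fract(2)[of 0 z]
    eval_rf_to_fract(1)[of z 1] eval_rf_to_fract(2)[of 1 z] by simp_all

lemma eval_rf_sum:
  assumes "\<And>i. i \<in> I \<Longrightarrow> z \<notin> poles (f i)"
  shows "z \<notin> poles (sum f I) \<and> eval_rf (sum f I) z = (\<Sum>i\<in>I. eval_rf (f i) z)"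
  using assms
proof (induction I rule: infinite_finite_induct)
  case (insert i I)
  then show ?case by (simp add: eval_rf_add)
qed (simp_all add: eval_rf_0_1)

definition regular_mat :: "complex \<Rightarrow> ratfun mat \<Rightarrow> bool" where
  "regular_mat z H \<longleftrightarrow> (\<forall>i<dim_row H. \<forall>j<dim_col H. z \<notin> poles (H $$ (i, j)))"

abbreviation eval_mat :: "complex \<Rightarrow> ratfun mat \<Rightarrow> complex mat" where
  "eval_mat z \<equiv> map_mat (\<lambda>f. eval_rf f z)"

lemma eval_mat_mult:
  assumes G: "G \<in> carrier_mat m n" "regular_mat z G" and H: "H \<in> carrier_mat n k" "regular_mat z H"
  shows "regular_mat z (G * H)" and "eval_mat z (G * H) = eval_mat z G * eval_mat z H"
proof -
  have entry: "z \<notin> poles ((G * H) $$ (i, j)) \<and>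
      eval_rf ((G * H) $$ (i, j)) z = (\<Sum>l<n. eval_rf (G $$ (i, l)) z * eval_rf (H $$ (l, j)) z)"
    if "i < m" "j < k" for i j
  proof -
    have reg: "z \<notin> poles (G $$ (i, l))" "z \<notin> poles (H $$ (l, j))" if "l < n" for l
      using \<open>i < m\<close> \<open>j < k\<close> that G H by (auto simp: regular_mat_def)
    have "(G * H) $$ (i, j) = (\<Sum>l<n. G $$ (i, l) * H $$ (l, j))"
      using that G H by (simp add: scalar_prod_def atLeast0LessThan)
    moreover have "z \<notin> poles (\<Sum>l<n. G $$ (i, l) * H $$ (l, j)) \<and>
        eval_rf (\<Sum>l<n. G $$ (i, l) * H $$ (l, j)) z = (\<Sum>l<n. eval_rf (G $$ (i, l) * H $$ (l, j)) z)"
      by (rule eval_rf_sum) (simp add: eval_rf_mult reg)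
    ultimately show ?thesis by (simp add: eval_rf_mult reg)
  qed
  show "regular_mat z (G * H)" using entry G H by (auto simp: regular_mat_def)
  show "eval_mat z (G * H) = eval_mat z G * eval_mat z H"
    using entry G H by (intro eq_matI) (auto simp: scalar_prod_def atLeast0LessThan)
qed

lemma eval_mat_const: "regular_mat z (map_mat const_rf M)" "eval_mat z (map_mat const_rf M) = cmat M"
proof -
  show "regular_mat z (map_mat const_rf M)" by (simp add: regular_mat_def eval_rf_const)
  show "eval_mat z (map_mat const_rf M) = cmat M" by (rule eq_matI) (simp_all add: eval_rf_const)
qed

lemma eval_mat_one: "regular_mat z (1\<^sub>m n)" "eval_mat z (1\<^sub>m n) = 1\<^sub>m n"
proof -
  show "regular_mat z (1\<^sub>m n)" by (simp add: regular_mat_def eval_rf_0_1)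
  show "eval_mat z (1\<^sub>m n) = 1\<^sub>m n" by (rule eq_matI) (simp_all add: eval_rf_0_1)
qed

lemma eval_mat_append_rows:
  assumes G: "G \<in> carrier_mat m n" "regular_mat z G" and H: "H \<in> carrier_mat k n" "regular_mat z H"
  shows "regular_mat z (G @\<^sub>r H)" and "eval_mat z (G @\<^sub>r H) = eval_mat z G @\<^sub>r eval_mat z H"
proof -
  have dims: "dim_row G = m" "dim_col G = n" "dim_row H = k" "dim_col H = n" using G H by auto
  show "regular_mat z (G @\<^sub>r H)"
    using G(2) H(2) by (simp add: regular_mat_def append_rows_def dims)
  show "eval_mat z (G @\<^sub>r H) = eval_mat z G @\<^sub>r eval_mat z H"
    by (rule eq_matI) (simp_all add: append_rows_def dims)
qed

lemma regular_mat_imaginary_axis: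
  assumes "H \<in> RL_inf m n \<or> H \<in> RH_inf m n" and z: "Re z = 0"
  shows "regular_mat z H"
proof -
  have dims: "dim_row H = m" "dim_col H = n" using assms(1) by (auto simp: RL_inf_def RH_inf_def)
  have "Re z' \<noteq> 0" if "i < m" "j < n" "z' \<in> poles (H $$ (i, j))" for i j z'
    using assms(1) that by (fastforce simp: RL_inf_def RH_inf_def)
  then show ?thesis using z unfolding regular_mat_def dims by blast
qed

lemma eval_rf_diff:
  assumes "z \<notin> poles f" and "z \<notin> poles g"
  shows "z \<notin> poles (f - g)" and "eval_rf (f - g) z = eval_rf f z - eval_rf g z"
proof -
  have uminus_one: "[:- 1:] = (- 1 :: real poly)" by (simp add: one_pCons)
  have "const_rf (- 1) = - 1"
    by (simp add: const_rf_def uminus_one)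
  then have eq: "f - g = f + const_rf (- 1) * g" by simp
  have g: "z \<notin> poles (const_rf (- 1) * g)" "eval_rf (const_rf (- 1) * g) z = - eval_rf g z"
    using eval_rf_mult[OF eval_rf_const(1)[of z "- 1"] assms(2)] by (simp_all add: eval_rf_const)
  show "z \<notin> poles (f - g)" "eval_rf (f - g) z = eval_rf f z - eval_rf g z"
    unfolding eq using eval_rf_add[OF assms(1) g(1)] g(2) by simp_all
qed

lemma eval_mat_diff:
  assumes G: "G \<in> carrier_mat m n" "regular_mat z G" and H: "H \<in> carrier_mat m n" "regular_mat z H"
  shows "regular_mat z (G - H)" and "eval_mat z (G - H) = eval_mat z G - eval_mat z H"
proof -
  have dims: "dim_row G = m" "dim_col G = n" "dim_row H = m" "dim_col H = n" using G H by auto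
  have reg: "z \<notin> poles (G $$ (i, j))" "z \<notin> poles (H $$ (i, j))" if "i < m" "j < n" for i j
    using G(2) H(2) that by (simp_all add: regular_mat_def dims)
  show "regular_mat z (G - H)" by (simp add: regular_mat_def dims eval_rf_diff reg)
  show "eval_mat z (G - H) = eval_mat z G - eval_mat z H"
    by (rule eq_matI) (simp_all add: dims eval_rf_diff reg)
qed

lemma eval_mat_s:
  "regular_mat z (s_rf \<cdot>\<^sub>m 1\<^sub>m n)" "eval_mat z (s_rf \<cdot>\<^sub>m 1\<^sub>m n) = z \<cdot>\<^sub>m 1\<^sub>m n"
proof -
  have s: "z \<notin> poles s_rf" "eval_rf s_rf z = z"
    by (simp_all add: s_rf_def eval_rf_to_fract map_poly_simps)
  have entry: "z \<notin> poles (s_rf * (if i = j then 1 else 0))"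
      "eval_rf (s_rf * (if i = j then 1 else 0)) z = z * (if i = j then 1 else 0)" for i j :: nat
    by (simp_all add: s eval_rf_0_1)
  show "regular_mat z (s_rf \<cdot>\<^sub>m 1\<^sub>m n)" using entry(1) by (simp add: regular_mat_def)
  show "eval_mat z (s_rf \<cdot>\<^sub>m 1\<^sub>m n) = z \<cdot>\<^sub>m 1\<^sub>m n"
    using entry(2) by (intro eq_matI) simp_all
qed

section \<open>The closed loop at a fixed frequency\<close>

lemma return_diff_carrier:
  assumes "A \<in> carrier_mat N N" and "B \<in> carrier_mat N m" and "L \<in> carrier_mat m N"
  shows "return_diff A B L \<in> carrier_mat N N"
  using assms by (auto simp: return_diff_def)

lemma eval_return_diff:
  assumes A: "A \<in> carrier_mat N N" and B: "B \<in> carrier_mat N m"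
    and L: "L \<in> carrier_mat m N" "regular_mat z L"
  shows "regular_mat z (return_diff A B L)"
    and "eval_mat z (return_diff A B L) = z \<cdot>\<^sub>m 1\<^sub>m N - cmat A - cmat B * eval_mat z L"
proof -
  have cB: "map_mat const_rf B \<in> carrier_mat N m" and cA: "map_mat const_rf A \<in> carrier_mat N N"
    using A B by auto
  note BL = eval_mat_mult[OF cB eval_mat_const(1) L]
  have s: "s_rf \<cdot>\<^sub>m 1\<^sub>m N \<in> carrier_mat N N" by simp
  note sA = eval_mat_diff[OF s eval_mat_s(1) cA eval_mat_const(1)]
  have "s_rf \<cdot>\<^sub>m 1\<^sub>m N - map_mat const_rf A \<in> carrier_mat N N" "map_mat const_rf B * L \<in> carrier_mat N N"
    using cA cB L by auto
  note sAB = eval_mat_diff[OF this(1) sA(1) this(2) BL(1)]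
  have dim: "dim_row A = N" using A by simp
  show "regular_mat z (return_diff A B L)" unfolding return_diff_def dim by (rule sAB(1))
  show "eval_mat z (return_diff A B L) = z \<cdot>\<^sub>m 1\<^sub>m N - cmat A - cmat B * eval_mat z L"
    unfolding return_diff_def dim sAB(2) sA(2) BL(2) eval_mat_const eval_mat_s ..
qed

text \<open>The response to a disturbance \<open>w\<close> at the frequency \<open>z\<close> on the imaginary axis: the state \<open>x\<close> is the one that
  balances the plant under feedback, and the output is the pair of \<open>x\<close> and the input it causes. The
  bounds on gains below rest on this description alone.\<close>

lemma closed_loop_at_frequency:
  assumes A: "A \<in> carrier_mat N N" and B: "B \<in> carrier_mat N m"
    and L: "L \<in> feasible A B" and z: "Re z = 0" and w: "w \<in> carrier_vec N"
  obtains x where "x \<in> carrier_vec N"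
    and "w = z \<cdot>\<^sub>v x - cmat A *\<^sub>v x - cmat B *\<^sub>v (eval_mat z L *\<^sub>v x)"
    and "eval_mat z (closed_loop A B L) *\<^sub>v w = x @\<^sub>v (eval_mat z L *\<^sub>v x)"
proof -
  have dims: "dim_row A = N" "dim_col B = m" using A B by auto
  have LRL: "L \<in> RL_inf m N" and "stabilizing A B L" using L by (auto simp: feasible_def dims)
  then obtain G where G: "mat_inverse (return_diff A B L) = Some G" "G \<in> RH_inf N N"
    by (auto simp: stabilizing_def dims)
  have Lc: "L \<in> carrier_mat m N" using LRL by (simp add: RL_inf_def)
  have Gc: "G \<in> carrier_mat N N" using G(2) by (simp add: RH_inf_def)
  have Lreg: "regular_mat z L" and Greg: "regular_mat z G"
    using LRL G(2) z by (auto intro: regular_mat_imaginary_axis)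
  note R = return_diff_carrier[OF A B Lc]
  note evR = eval_return_diff[OF A B Lc Lreg]
  have ecarr: "eval_mat z G \<in> carrier_mat N N" "eval_mat z L \<in> carrier_mat m N"
    "cmat A \<in> carrier_mat N N" "cmat B \<in> carrier_mat N m" using Gc Lc A B by auto
  define x where "x = eval_mat z G *\<^sub>v w"
  have x: "x \<in> carrier_vec N" using ecarr w by (simp add: x_def)
  have "eval_mat z (return_diff A B L * G) = 1\<^sub>m N"
    using mat_inverse(2)[OF R G(1)] by (simp add: eval_mat_one)
  then have "eval_mat z (return_diff A B L) * eval_mat z G = 1\<^sub>m N"
    using eval_mat_mult(2)[OF R evR(1) Gc Greg] by simp
  then have "eval_mat z (return_diff A B L) *\<^sub>v x = w"
    using assoc_mult_mat_vec[of "eval_mat z (return_diff A B L)" N N "eval_mat z G" N w] R ecarr w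
    by (simp add: x_def)
  moreover have "(z \<cdot>\<^sub>m 1\<^sub>m N - cmat A - cmat B * eval_mat z L) *\<^sub>v x
      = z \<cdot>\<^sub>v x - cmat A *\<^sub>v x - cmat B *\<^sub>v (eval_mat z L *\<^sub>v x)"
  proof -
    have "(z \<cdot>\<^sub>m 1\<^sub>m N - cmat A - cmat B * eval_mat z L) *\<^sub>v x
        = (z \<cdot>\<^sub>m 1\<^sub>m N - cmat A) *\<^sub>v x - (cmat B * eval_mat z L) *\<^sub>v x"
      by (rule minus_mult_distrib_mat_vec) (use ecarr x in auto)
    also have "(z \<cdot>\<^sub>m 1\<^sub>m N - cmat A) *\<^sub>v x = (z \<cdot>\<^sub>m 1\<^sub>m N) *\<^sub>v x - cmat A *\<^sub>v x"
      by (rule minus_mult_distrib_mat_vec) (use ecarr x in auto)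
    also have "(z \<cdot>\<^sub>m 1\<^sub>m N) *\<^sub>v x = z \<cdot>\<^sub>v x"
      using x by (intro eq_vecI) simp_all
    also have "(cmat B * eval_mat z L) *\<^sub>v x = cmat B *\<^sub>v (eval_mat z L *\<^sub>v x)"
      using ecarr x by (intro assoc_mult_mat_vec) auto
    finally show ?thesis .
  qed
  ultimately have w_eq: "w = z \<cdot>\<^sub>v x - cmat A *\<^sub>v x - cmat B *\<^sub>v (eval_mat z L *\<^sub>v x)"
    using evR(2) by simp
  note rows = eval_mat_append_rows[OF one_carrier_mat eval_mat_one(1) Lc Lreg]
  have "1\<^sub>m N @\<^sub>r L \<in> carrier_mat (N + m) N" using Lc by auto
  then have "eval_mat z (closed_loop A B L) = (1\<^sub>m N @\<^sub>r eval_mat z L) * eval_mat z G"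
    using eval_mat_mult(2)[OF _ rows(1) Gc Greg] rows(2) G(1)
    by (simp add: closed_loop_def dims eval_mat_one)
  moreover have "((1\<^sub>m N @\<^sub>r eval_mat z L) * eval_mat z G) *\<^sub>v w = (1\<^sub>m N @\<^sub>r eval_mat z L) *\<^sub>v x"
    unfolding x_def by (rule assoc_mult_mat_vec[of _ "N + m" N _ N]) (use ecarr w in auto)
  moreover have "(1\<^sub>m N @\<^sub>r eval_mat z L) *\<^sub>v x = x @\<^sub>v (eval_mat z L *\<^sub>v x)"
    using mat_mult_append[OF one_carrier_mat ecarr(2) x] x by simp
  ultimately show thesis using that x w_eq by metis
qed

section \<open>Resolvents of Hurwitz matrices\<close>

lemma mat_inverse_exists:
  assumes A: "A \<in> carrier_mat n n" and "det A \<noteq> 0"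
  obtains G where "mat_inverse A = Some G"
  using mat_inverse(1)[OF A, of "()"] det_non_zero_imp_unit[OF A assms(2), of "()"]
  by (cases "mat_inverse A") auto

lemma const_rf_hom: "comm_ring_hom const_rf"
  by unfold_locales
    (simp_all add: const_rf_def one_pCons[symmetric] flip: to_fract_add to_fract_mult)

text \<open>For a static controller the return difference is a polynomial matrix, which makes the theory of
  characteristic polynomials available.\<close>

lemma return_diff_const:
  assumes A: "A \<in> carrier_mat N N" and B: "B \<in> carrier_mat N m" and K: "K \<in> carrier_mat m N"
  shows "return_diff A B (map_mat const_rf K) = map_mat to_fract (char_poly_matrix (A + B * K))"
proof -
  interpret c: comm_ring_hom const_rf by (rule const_rf_hom)
  have BK: "map_mat const_rf B * map_mat const_rf K = map_mat const_rf (B * K)"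
    using c.mat_hom_mult[OF B K] by simp
  have neg: "- to_fract [:a:] - to_fract [:b:] = to_fract [:- a - b:]" for a b :: real
    by (simp flip: to_fract_uminus to_fract_diff)
  show ?thesis
    unfolding return_diff_def BK using A B K
    by (intro eq_matI)
      (simp_all add: char_poly_matrix_def s_rf_def const_rf_def neg flip: to_fract_diff to_fract_uminus)
qed

text \<open>A cofactor is a determinant of size \<open>n - 1\<close> of polynomials of degree at most one. The bound \<open>n\<close>
  is what properness of the resolvent needs.\<close>

lemma degree_adj_char_poly_matrix:
  assumes M: "M \<in> carrier_mat n n" and i: "i < n" and j: "j < n"
  shows "degree (adj_mat (char_poly_matrix M) $$ (i, j)) \<le> n"
proof -
  let ?C = "char_poly_matrix M"
  let ?D = "mat_delete ?C j i"
  have C: "?C \<in> carrier_mat n n" using M by simp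
  have D: "?D \<in> carrier_mat (n - 1) (n - 1)" using C by (rule mat_delete_carrier)
  have "degree (?C $$ (k, l)) \<le> 1" if "k < n" "l < n" for k l
    using that M by (simp add: char_poly_matrix_def)
  then have "degree (?D $$ (k, l)) \<le> 1" if "k < n - 1" "l < n - 1" for k l
    using that C by (auto simp: mat_delete_def)
  then have "degree (det ?D) \<le> 1 * (n - 1)" by (rule degree_det_le[OF _ D])
  moreover have "adj_mat ?C $$ (i, j) = (- 1) ^ (j + i) * det ?D"
    using i j C by (simp add: adj_mat_def cofactor_def)
  moreover have "degree ((- 1) ^ (j + i) * det ?D) = degree (det ?D)"
    by (cases "even (j + i)") simp_all
  ultimately show ?thesis by simp
qed

text \<open>By Cramer's rule the entries of the resolvent are cofactors over the characteristic polynomial.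
  They are proper by the degree bound on cofactors, and their poles are eigenvalues.\<close>

lemma resolvent_in_RH_inf:
  assumes M: "M \<in> carrier_mat n n" and hurwitz: "\<And>k. eigenvalue (cmat M) k \<Longrightarrow> Re k < 0"
  shows "\<exists>G. mat_inverse (map_mat to_fract (char_poly_matrix M)) = Some G \<and> G \<in> RH_inf n n"
proof -
  interpret tf: comm_ring_hom "to_fract :: real poly \<Rightarrow> ratfun" by unfold_locales simp_all
  let ?C = "char_poly_matrix M" and ?\<chi> = "char_poly M"
  let ?R = "map_mat to_fract ?C"
  have C: "?C \<in> carrier_mat n n" using M by simp
  have R: "?R \<in> carrier_mat n n" using C by simp
  have detR: "det ?R = to_fract ?\<chi>" using tf.hom_det[of ?C] by (simp add: char_poly_def)
  have deg: "degree ?\<chi> = n" and "lead_coeff ?\<chi> = 1" using degree_monic_char_poly[OF M] by auto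
  then have \<chi>: "?\<chi> \<noteq> 0" by auto
  obtain G where G: "mat_inverse ?R = Some G"
    using mat_inverse_exists[OF R] detR \<chi> by auto
  have RG: "?R * G = 1\<^sub>m n" and Gc: "G \<in> carrier_mat n n" using mat_inverse(2)[OF R G] by auto
  note adj = adj_mat[OF C]
  have scaled: "map_mat to_fract (c \<cdot>\<^sub>m X) = to_fract c \<cdot>\<^sub>m map_mat to_fract X" for c :: "real poly" and X
    by (rule eq_matI) simp_all
  have aR: "map_mat to_fract (adj_mat ?C) * ?R = to_fract ?\<chi> \<cdot>\<^sub>m 1\<^sub>m n"
    using tf.mat_hom_mult[OF adj(1) C] adj(3)
    by (simp add: char_poly_def tf.mat_hom_one scaled)
  have "map_mat to_fract (adj_mat ?C) = map_mat to_fract (adj_mat ?C) * (?R * G)"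
    using RG adj(1) by simp
  also have "\<dots> = (map_mat to_fract (adj_mat ?C) * ?R) * G"
    by (rule assoc_mult_mat[symmetric]) (use adj(1) R Gc in auto)
  also have "\<dots> = to_fract ?\<chi> \<cdot>\<^sub>m G"
    using Gc unfolding aR by (subst mult_smult_assoc_mat[of _ n n _ n]) auto
  finally have cramer: "map_mat to_fract (adj_mat ?C) = to_fract ?\<chi> \<cdot>\<^sub>m G" .
  have entry: "G $$ (i, j) = Fract (adj_mat ?C $$ (i, j)) ?\<chi>" if "i < n" "j < n" for i j
  proof -
    have "to_fract (adj_mat ?C $$ (i, j)) = to_fract ?\<chi> * G $$ (i, j)"
      using arg_cong[OF cramer, of "\<lambda>X. X $$ (i, j)"] that adj(1) Gc by simp
    then show ?thesis using \<chi> by (simp add: Fract_conv_to_fract field_simps)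
  qed
  have "Re z < 0" if "cpoly ?\<chi> z = 0" for z
  proof -
    have "char_poly (cmat M) = map_poly complex_of_real ?\<chi>"
      using of_real_hom.char_poly_hom[OF M] .
    then have "eigenvalue (cmat M) z"
      using that M by (subst eigenvalue_root_char_poly[of _ n]) auto
    then show ?thesis by (rule hurwitz)
  qed
  then have "G \<in> RH_inf n n"
    using Gc entry degree_adj_char_poly_matrix[OF M] deg \<chi>
    by (auto simp: RH_inf_def intro!: proper_Fract dest!: poles_Fract_imp_root[OF \<chi>])
  with G show ?thesis by blast
qed

section \<open>Symmetric systems\<close>

lemma closed_loop_dim_col:
  assumes "A \<in> carrier_mat n n" and "L \<in> feasible A B"
  shows "dim_col (closed_loop A B L) = n"
  using assms by (auto simp: feasible_def stabilizing_def closed_loop_def RH_inf_def)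

text \<open>The form is real since \<open>A\<close> is symmetric. Its real part is the sum of the quadratic form at the
  real and at the imaginary part of \<open>p\<close>, which brings the definiteness over the reals to bear.\<close>

lemma hermitian_form_real_nonpos:
  assumes A: "A \<in> carrier_mat n n" and sym: "A\<^sup>T = A"
    and neg: "\<And>v. v \<in> carrier_vec n \<Longrightarrow> v \<noteq> 0\<^sub>v n \<Longrightarrow> (A *\<^sub>v v) \<bullet> v < 0"
    and p: "p \<in> carrier_vec n"
  shows "Im ((cmat A *\<^sub>v p) \<bullet>c p) = 0" and "Re ((cmat A *\<^sub>v p) \<bullet>c p) \<le> 0"
proof -
  have Ap: "cmat A *\<^sub>v p \<in> carrier_vec n" using A p by simp
  have "cnj ((cmat A *\<^sub>v p) \<bullet>c p) = p \<bullet>c (cmat A *\<^sub>v p)"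
    using conjugate_conjugate_sprod[OF p Ap] conjugate_vec_sprod_comm[OF Ap p]
    by (simp add: conjugate_complex_def)
  also have "\<dots> = (cmat A *\<^sub>v p) \<bullet>c p"
    using cscalar_prod_adjoint[OF A p p] by (simp add: sym)
  finally have "Im (cnj ((cmat A *\<^sub>v p) \<bullet>c p)) = Im ((cmat A *\<^sub>v p) \<bullet>c p)" by (rule arg_cong)
  then show "Im ((cmat A *\<^sub>v p) \<bullet>c p) = 0" by simp
  have nonpos: "(A *\<^sub>v v) \<bullet> v \<le> 0" if "v \<in> carrier_vec n" for v
    using neg[OF that] A by (cases "v = 0\<^sub>v n") auto
  let ?r = "map_vec Re p" and ?i = "map_vec Im p"
  have form: "(A *\<^sub>v map_vec f p) \<bullet> map_vec f p = (\<Sum>i<n. \<Sum>j<n. A $$ (i, j) * f (p $ j) * f (p $ i))" for f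
    using A p by (simp add: scalar_prod_def atLeast0LessThan sum_distrib_right)
  have "Re ((cmat A *\<^sub>v p) \<bullet>c p)
      = (\<Sum>i<n. \<Sum>j<n. A $$ (i, j) * Re (p $ j) * Re (p $ i) + A $$ (i, j) * Im (p $ j) * Im (p $ i))"
    using A p by (simp add: scalar_prod_def atLeast0LessThan sum_distrib_right)
  also have "\<dots> = (A *\<^sub>v ?r) \<bullet> ?r + (A *\<^sub>v ?i) \<bullet> ?i"
    by (simp add: form sum.distrib)
  also have "\<dots> \<le> 0" using nonpos[of ?r] nonpos[of ?i] p by simp
  finally show "Re ((cmat A *\<^sub>v p) \<bullet>c p) \<le> 0" .
qed

text \<open>This pairing is the source of both bounds: symmetry of \<open>A\<close> moves the two matrices from the
  signals \<open>x\<close>, \<open>u\<close> to the test vector \<open>p\<close>.\<close>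

lemma cscalar_prod_drive:
  assumes A: "A \<in> carrier_mat n n" and sym: "A\<^sup>T = A" and B: "B \<in> carrier_mat n m"
    and x: "x \<in> carrier_vec n" and u: "u \<in> carrier_vec m" and p: "p \<in> carrier_vec n"
  shows "(z \<cdot>\<^sub>v x - cmat A *\<^sub>v x - cmat B *\<^sub>v u) \<bullet>c p
    = z * (x \<bullet>c p) - (x @\<^sub>v u) \<bullet>c ((cmat A *\<^sub>v p) @\<^sub>v (cmat B\<^sup>T *\<^sub>v p))"
proof -
  have carr: "cmat A *\<^sub>v x \<in> carrier_vec n" "cmat B *\<^sub>v u \<in> carrier_vec n"
    "cmat A *\<^sub>v p \<in> carrier_vec n" "cmat B\<^sup>T *\<^sub>v p \<in> carrier_vec m" "conjugate p \<in> carrier_vec n"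
    using A B x u p by auto
  have "(z \<cdot>\<^sub>v x - cmat A *\<^sub>v x - cmat B *\<^sub>v u) \<bullet>c p
      = (z \<cdot>\<^sub>v x - cmat A *\<^sub>v x) \<bullet>c p - (cmat B *\<^sub>v u) \<bullet>c p"
    using carr x by (intro minus_scalar_prod_distrib) auto
  also have "(z \<cdot>\<^sub>v x - cmat A *\<^sub>v x) \<bullet>c p = (z \<cdot>\<^sub>v x) \<bullet>c p - (cmat A *\<^sub>v x) \<bullet>c p"
    using carr x by (intro minus_scalar_prod_distrib) auto
  also have "(z \<cdot>\<^sub>v x) \<bullet>c p = z * (x \<bullet>c p)"
    using carr(5) x by simp
  also have "(cmat A *\<^sub>v x) \<bullet>c p = x \<bullet>c (cmat A *\<^sub>v p)"
    using cscalar_prod_adjoint[OF A x p] by (simp add: sym)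
  also have "(cmat B *\<^sub>v u) \<bullet>c p = u \<bullet>c (cmat B\<^sup>T *\<^sub>v p)"
    by (rule cscalar_prod_adjoint[OF B u p])
  finally show ?thesis
    using cscalar_prod_append[OF x u carr(3,4)] by simp
qed

text \<open>In the pairing of the disturbance with \<open>p\<close> the vector paired with the output is the output
  itself. The term with \<open>z\<close> has a real part of the sign of \<open>- Re z\<close> because \<open>\<langle>A p, p\<rangle>\<close> is real and at
  most zero, so it can be dropped and the square of the output remains.\<close>

lemma energy_estimate:
  assumes A: "A \<in> carrier_mat n n" and sym: "A\<^sup>T = A"
    and neg: "\<And>v. v \<in> carrier_vec n \<Longrightarrow> v \<noteq> 0\<^sub>v n \<Longrightarrow> (A *\<^sub>v v) \<bullet> v < 0"
    and B: "B \<in> carrier_mat n m" and p: "p \<in> carrier_vec n" and z: "Re z \<ge> 0"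
    and x: "x = cmat A *\<^sub>v p" and u: "u = cmat B\<^sup>T *\<^sub>v p"
  shows "(vec_norm2 (x @\<^sub>v u))\<^sup>2 \<le> vec_norm2 p * vec_norm2 (z \<cdot>\<^sub>v x - cmat A *\<^sub>v x - cmat B *\<^sub>v u)"
proof -
  let ?w = "z \<cdot>\<^sub>v x - cmat A *\<^sub>v x - cmat B *\<^sub>v u"
  have xc: "x \<in> carrier_vec n" and uc: "u \<in> carrier_vec m" using A B p by (auto simp: x u)
  have wc: "?w \<in> carrier_vec n" using A B xc uc by auto
  have "?w \<bullet>c p = z * (x \<bullet>c p) - complex_of_real ((vec_norm2 (x @\<^sub>v u))\<^sup>2)"
    unfolding vec_norm2_square cscalar_prod_drive[OF A sym B xc uc p] by (simp only: x u)
  then have "(vec_norm2 (x @\<^sub>v u))\<^sup>2 = Re (z * (x \<bullet>c p)) - Re (?w \<bullet>c p)" by simp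
  also have "Re (z * (x \<bullet>c p)) \<le> 0"
    using hermitian_form_real_nonpos[OF A sym neg p] z by (simp add: x mult_nonneg_nonpos)
  also have "0 - Re (?w \<bullet>c p) \<le> vec_norm2 p * vec_norm2 ?w"
    using abs_Re_le_cmod[of "?w \<bullet>c p"] cauchy_schwarz_cvec[OF wc p] by (simp add: mult.commute)
  finally show ?thesis by simp
qed

lemma le_if_square_le_mult:
  fixes x c :: real
  assumes "x * x \<le> c * x" and "c \<ge> 0"
  shows "x \<le> c"
proof (rule ccontr)
  assume "\<not> x \<le> c"
  then have "c * x < x * x" using assms(2) by (intro mult_strict_right_mono) auto
  then show False using assms(1) by simp
qed

text \<open>At \<open>z = 0\<close> the pairing has no term with \<open>z\<close> and holds for arbitrary \<open>x\<close> and \<open>u\<close>; so the controller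
  enters only through the gain of its closed loop. The disturbance is chosen equal to the test
  vector \<open>p\<close>.\<close>

lemma static_gain_lower_bound:
  assumes A: "A \<in> carrier_mat n n" and sym: "A\<^sup>T = A" and B: "B \<in> carrier_mat n m"
    and L: "L \<in> feasible A B" and p: "p \<in> carrier_vec n"
  shows "vec_norm2 p \<le> spectral_norm (eval_mat 0 (closed_loop A B L))
    * vec_norm2 ((cmat A *\<^sub>v p) @\<^sub>v (cmat B\<^sup>T *\<^sub>v p))"
proof -
  let ?G = "eval_mat 0 (closed_loop A B L)"
  let ?q = "(cmat A *\<^sub>v p) @\<^sub>v (cmat B\<^sup>T *\<^sub>v p)"
  obtain x where x: "x \<in> carrier_vec n"
    and p_eq: "p = 0 \<cdot>\<^sub>v x - cmat A *\<^sub>v x - cmat B *\<^sub>v (eval_mat 0 L *\<^sub>v x)"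
    and Gp: "?G *\<^sub>v p = x @\<^sub>v (eval_mat 0 L *\<^sub>v x)"
    using closed_loop_at_frequency[OF A B L _ p, of 0] by auto
  have Lc: "L \<in> carrier_mat m n" using L A B by (auto simp: feasible_def RL_inf_def)
  define u where "u = eval_mat 0 L *\<^sub>v x"
  have u: "u \<in> carrier_vec m" using Lc x by (simp add: u_def)
  have qc: "?q \<in> carrier_vec (n + m)" and xu: "x @\<^sub>v u \<in> carrier_vec (n + m)"
    using A B p x u by auto
  have "p \<bullet>c p = - ((x @\<^sub>v u) \<bullet>c ?q)"
    using cscalar_prod_drive[OF A sym B x u p, of 0] p_eq by (simp flip: u_def)
  then have "complex_of_real ((vec_norm2 p)\<^sup>2) = - ((x @\<^sub>v u) \<bullet>c ?q)" by (simp only: vec_norm2_square)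
  then have "(vec_norm2 p)\<^sup>2 = cmod ((x @\<^sub>v u) \<bullet>c ?q)"
    by (metis norm_minus_cancel norm_of_real abs_power2)
  also have "\<dots> \<le> vec_norm2 (?G *\<^sub>v p) * vec_norm2 ?q"
    using cauchy_schwarz_cvec[OF xu qc] by (simp add: Gp u_def)
  also have "\<dots> \<le> (spectral_norm ?G * vec_norm2 p) * vec_norm2 ?q"
  proof (rule mult_right_mono[OF vec_norm2_le_spectral_norm vec_norm2_nonneg])
    show "p \<in> carrier_vec (dim_col ?G)" using p by (simp add: closed_loop_dim_col[OF A L])
  qed
  finally have "vec_norm2 p * vec_norm2 p \<le> (spectral_norm ?G * vec_norm2 ?q) * vec_norm2 p"
    by (simp add: power2_eq_square mult_ac)
  then show ?thesis
    by (rule le_if_square_le_mult) (simp add: vec_norm2_nonneg spectral_norm_nonneg)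
qed

text \<open>The equation \<open>K A = B\<^sup>T\<close> determines \<open>K = B\<^sup>T A\<^sup>-\<^sup>1\<close>, as \<open>A\<close> is invertible. Optimality is shown in
  a strong form: the gain of \<open>K\<close> at each frequency is at most the gain of any competitor at
  frequency zero.\<close>

theorem symmetric_hinf_optimal:
  assumes A: "A \<in> carrier_mat n n" and sym: "A\<^sup>T = A"
    and neg: "\<And>v. v \<in> carrier_vec n \<Longrightarrow> v \<noteq> 0\<^sub>v n \<Longrightarrow> (A *\<^sub>v v) \<bullet> v < 0"
    and B: "B \<in> carrier_mat n m" and K: "K \<in> carrier_mat m n" and KA: "K * A = B\<^sup>T"
  shows "solves_hinf A B K"
proof -
  let ?K = "map_mat const_rf K"
  have "det A \<noteq> 0"
    using det_0_iff_vec_prod_zero[OF A] neg by force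
  then obtain Ai where "mat_inverse A = Some Ai" using mat_inverse_exists[OF A] by blast
  then have AAi: "A * Ai = 1\<^sub>m n" and Ai: "Ai \<in> carrier_mat n n" using mat_inverse(2)[OF A] by auto
  \<comment> \<open>Invertibility of \<open>A\<close> allows every state to be written as \<open>A p\<close>.\<close>
  have estimate: "\<exists>p \<in> carrier_vec n. x @\<^sub>v (cmat K *\<^sub>v x) = (cmat A *\<^sub>v p) @\<^sub>v (cmat B\<^sup>T *\<^sub>v p) \<and>
      (vec_norm2 (x @\<^sub>v (cmat K *\<^sub>v x)))\<^sup>2
        \<le> vec_norm2 p * vec_norm2 (z \<cdot>\<^sub>v x - cmat A *\<^sub>v x - cmat B *\<^sub>v (cmat K *\<^sub>v x))"
    if x: "x \<in> carrier_vec n" and z: "Re z \<ge> 0" for x z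
  proof -
    define p where "p = cmat Ai *\<^sub>v x"
    have p: "p \<in> carrier_vec n" using Ai x by (simp add: p_def)
    have "cmat A * cmat Ai = 1\<^sub>m n"
      using of_real_hom.mat_hom_mult[OF A Ai, where 'a = complex] by (simp add: AAi of_real_hom.mat_hom_one)
    then have xp: "x = cmat A *\<^sub>v p"
      using assoc_mult_mat_vec[of "cmat A" n n "cmat Ai" n x] A Ai x by (simp add: p_def)
    have "cmat K * cmat A = cmat B\<^sup>T"
      using of_real_hom.mat_hom_mult[OF K A, where 'a = complex] by (simp add: KA)
    then have up: "cmat K *\<^sub>v x = cmat B\<^sup>T *\<^sub>v p"
      using assoc_mult_mat_vec[of "cmat K" m n "cmat A" n p] K A p by (simp add: xp)
    show ?thesis
      using energy_estimate[OF A sym neg B p z xp up] p xp up by metis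
  qed
  have "Re k < 0" if eig: "eigenvalue (cmat (A + B * K)) k" for k
  proof (rule ccontr)
    assume "\<not> Re k < 0"
    then have k: "Re k \<ge> 0" by simp
    obtain v where "eigenvector (cmat (A + B * K)) v k"
      using eig unfolding eigenvalue_def by blast
    then have v: "v \<in> carrier_vec n" "v \<noteq> 0\<^sub>v n" and ev: "cmat (A + B * K) *\<^sub>v v = k \<cdot>\<^sub>v v"
      using A B K by (simp_all add: eigenvector_def)
    have "cmat (A + B * K) = cmat A + cmat (B * K)"
      using A B K by (intro eq_matI) (simp_all del: index_mult_mat(1))
    then have "cmat (A + B * K) = cmat A + cmat B * cmat K"
      using of_real_hom.mat_hom_mult[OF B K, where 'a = complex] by simp
    then have "k \<cdot>\<^sub>v v = cmat A *\<^sub>v v + (cmat B * cmat K) *\<^sub>v v"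
      using ev A B K v by (metis add_mult_distrib_mat_vec map_carrier_mat mult_carrier_mat)
    also have "(cmat B * cmat K) *\<^sub>v v = cmat B *\<^sub>v (cmat K *\<^sub>v v)"
      using B K v by (intro assoc_mult_mat_vec) auto
    finally have "k \<cdot>\<^sub>v v - cmat A *\<^sub>v v - cmat B *\<^sub>v (cmat K *\<^sub>v v) = 0\<^sub>v n"
      using A B K v by (intro eq_vecI) auto
    moreover have "vec_norm2 (0\<^sub>v n) = 0" by (simp add: vec_norm2_def L2_set_def)
    ultimately have "(vec_norm2 (v @\<^sub>v (cmat K *\<^sub>v v)))\<^sup>2 \<le> 0"
      using estimate[OF v(1) k] by auto
    then have "(vec_norm2 v)\<^sup>2 \<le> 0"
      using zero_le_power2[of "vec_norm2 (cmat K *\<^sub>v v)"] unfolding vec_norm2_append_square by linarith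
    then have "vec_norm2 v = 0" by simp
    then show False using vec_norm2_eq_0[OF v(1)] v(2) by blast
  qed
  then have "stabilizing A B ?K"
    using resolvent_in_RH_inf[of "A + B * K" n] return_diff_const[OF A B K] A B K
    by (simp add: stabilizing_def)
  moreover have "?K \<in> RL_inf m n"
    using K proper_const eval_rf_const(1) by (auto simp: RL_inf_def)
  ultimately have feas: "?K \<in> feasible A B" using A B by (simp add: feasible_def)
  have "inf_norm (closed_loop A B ?K) \<le> inf_norm (closed_loop A B L)" if L: "L \<in> feasible A B" for L
  proof -
    let ?\<sigma> = "spectral_norm (eval_mat 0 (closed_loop A B L))"
    have "spectral_norm (eval_mat (\<i> * complex_of_real \<omega>) (closed_loop A B ?K)) \<le> ?\<sigma>" for \<omega>
    proof (rule spectral_norm_le)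
      let ?z = "\<i> * complex_of_real \<omega>"
      let ?G = "eval_mat ?z (closed_loop A B ?K)"
      fix w assume w: "w \<in> carrier_vec (dim_col ?G)" and w1: "vec_norm2 w \<le> 1"
      have wc: "w \<in> carrier_vec n" using w by (simp add: closed_loop_dim_col[OF A feas])
      obtain x where x: "x \<in> carrier_vec n"
        and w_eq: "w = ?z \<cdot>\<^sub>v x - cmat A *\<^sub>v x - cmat B *\<^sub>v (cmat K *\<^sub>v x)"
        and Gw: "?G *\<^sub>v w = x @\<^sub>v (cmat K *\<^sub>v x)"
        using closed_loop_at_frequency[OF A B feas _ wc, of ?z] by (auto simp: eval_mat_const)
      obtain p where p: "p \<in> carrier_vec n"
        and q: "x @\<^sub>v (cmat K *\<^sub>v x) = (cmat A *\<^sub>v p) @\<^sub>v (cmat B\<^sup>T *\<^sub>v p)"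
        and est: "(vec_norm2 (x @\<^sub>v (cmat K *\<^sub>v x)))\<^sup>2 \<le> vec_norm2 p * vec_norm2 w"
        using estimate[OF x, of ?z] w_eq by auto
      let ?g = "vec_norm2 (?G *\<^sub>v w)"
      \<comment> \<open>Both bounds concern the same output vector, and \<open>p\<close> cancels between them.\<close>
      have "?g * ?g \<le> vec_norm2 p * 1"
        using est w1 mult_left_mono[OF w1 vec_norm2_nonneg[of p]] by (simp add: Gw power2_eq_square)
      also have "\<dots> \<le> ?\<sigma> * ?g"
        using static_gain_lower_bound[OF A sym B L p] by (simp add: Gw q)
      finally show "?g \<le> ?\<sigma>"
        by (rule le_if_square_le_mult) (rule spectral_norm_nonneg)
    qed
    then have "inf_norm (closed_loop A B ?K) \<le> ereal ?\<sigma>"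
      unfolding inf_norm_def by (intro SUP_least) simp
    also have "\<dots> \<le> inf_norm (closed_loop A B L)"
      unfolding inf_norm_def by (rule SUP_upper2[of 0]) simp_all
    finally show ?thesis .
  qed
  then have "inf_norm (closed_loop A B ?K) = (INF L \<in> feasible A B. inf_norm (closed_loop A B L))"
    by (intro antisym INF_greatest INF_lower feas)
  with feas show ?thesis by (simp add: solves_hinf_def)
qed

section \<open>Networks of first-order subsystems\<close>

theorem proposition1:
  fixes N :: nat and a :: "nat \<Rightarrow> real"
    and E :: "(nat \<times> nat) set" and es :: "(nat \<times> nat) list"
  assumes "N \<ge> 1"
    and "\<And>i. i < N \<Longrightarrow> a i > 0"
    and "E \<subseteq> {..<N} \<times> {..<N}" and "sym E" and "irrefl E"
    and "distinct es" and "set es = E"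
  shows "solves_hinf (sys_A N a) (sys_B N es) (law_K N a es)"
proof (rule symmetric_hinf_optimal)
  let ?A = "sys_A N a"
  show "?A \<in> carrier_mat N N" "sys_B N es \<in> carrier_mat N (length es)"
    "law_K N a es \<in> carrier_mat (length es) N"
    by (simp_all add: sys_A_def sys_B_def law_K_def)
  show "?A\<^sup>T = ?A" by (rule eq_matI) (auto simp: sys_A_def)
  show "(?A *\<^sub>v v) \<bullet> v < 0" if v: "v \<in> carrier_vec N" "v \<noteq> 0\<^sub>v N" for v
  proof -
    have "(\<Sum>j<N. (if i = j then - a i else 0) * v $ j) = - a i * v $ i" if "i < N" for i
      using that by (subst sum.remove[of _ i]) auto
    then have "(?A *\<^sub>v v) \<bullet> v = (\<Sum>i<N. - (a i * (v $ i)\<^sup>2))"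
      using v by (simp add: sys_A_def scalar_prod_def atLeast0LessThan power2_eq_square mult.assoc)
    moreover obtain i where "i < N" "v $ i \<noteq> 0" using v by (metis carrier_vecD eq_vecI index_zero_vec)
    then have "(\<Sum>i<N. a i * (v $ i)\<^sup>2) > 0"
      using assms(2) by (intro sum_pos2[of _ i]) (auto simp: less_imp_le)
    ultimately show ?thesis by (simp add: sum_negf)
  qed
  show "law_K N a es * ?A = (sys_B N es)\<^sup>T"
  proof (rule eq_matI)
    fix k r assume "k < dim_row (sys_B N es)\<^sup>T" and "r < dim_col (sys_B N es)\<^sup>T"
    then have k: "k < length es" and r: "r < N" by (simp_all add: sys_B_def)
    have "(law_K N a es * ?A) $$ (k, r)
        = (\<Sum>j<N. law_K N a es $$ (k, j) * (if j = r then - a j else 0))"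
      using k r by (simp add: law_K_def sys_A_def scalar_prod_def atLeast0LessThan)
    also have "\<dots> = law_K N a es $$ (k, r) * - a r"
      using r by (subst sum.remove[of _ r]) auto
    also have "\<dots> = (sys_B N es)\<^sup>T $$ (k, r)"
      using k r assms(2)[OF r]
      by (cases "r = fst (es ! k)"; cases "r = snd (es ! k)") (simp_all add: law_K_def sys_B_def)
    finally show "(law_K N a es * ?A) $$ (k, r) = (sys_B N es)\<^sup>T $$ (k, r)" .
  qed (simp_all add: law_K_def sys_A_def sys_B_def)
qed

end
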